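(* Let $n\ge 3$ and let $G$ be a simple graph on $n$ vertices that contains no doubly chorded cycle. Then $\rho(G)\le \tfrac{1}{2}+\sqrt{2n-\tfrac{15}{4}}$, with equality if and only if $G\cong K_{1,1,n-2}$.
   Context: All graphs are finite and simple. $\rho(G)$ denotes the spectral radius of $G$, i.e. the largest eigenvalue of its adjacency matrix. For a cycle $C$ in $G$, a chord of $C$ is an edge of $G$ joining two vertices of $C$ that is not itself an edge of $C$. A doubly chorded cycle is a cycle with at least two chords; $G$ contains a doubly chorded cycle if some cycle of $G$ has at least two chords in $G$. $K_{1,1,n-2}$ is the complete tripartite graph with parts of sizes $1,1,n-2$. *)

theory Defs
  imports Complex_Main "HOL-Library.Cardinality"
begin

text \<open>A finite simple graph: vertex set is the finite type 'a (so n = CARD('a)),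
  edges given by a symmetric irreflexive relation.\<close>
definition simple_graph :: "('a::finite \<Rightarrow> 'a \<Rightarrow> bool) \<Rightarrow> bool" where
  "simple_graph E \<longleftrightarrow> (\<forall>x y. E x y \<longrightarrow> E y x) \<and> (\<forall>x. \<not> E x x)"

definition adj :: "('a \<Rightarrow> 'a \<Rightarrow> bool) \<Rightarrow> 'a \<Rightarrow> 'a \<Rightarrow> real" where
  "adj E x y = (if E x y then 1 else 0)"

text \<open>Real eigenvalue of the adjacency matrix (the matrix is symmetric, so all
  eigenvalues are real).\<close>
definition adj_eigenvalue :: "('a::finite \<Rightarrow> 'a \<Rightarrow> bool) \<Rightarrow> real \<Rightarrow> bool" where
  "adj_eigenvalue E \<mu> \<longleftrightarrow>
     (\<exists>x :: 'a \<Rightarrow> real. x \<noteq> (\<lambda>_. 0) \<and> (\<forall>v. (\<Sum>u\<in>UNIV. adj E v u * x u) = \<mu> * x v))"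

definition spectral_radius :: "('a::finite \<Rightarrow> 'a \<Rightarrow> bool) \<Rightarrow> real" where
  "spectral_radius E = Max {\<mu>. adj_eigenvalue E \<mu>}"

definition is_cycle :: "('a \<Rightarrow> 'a \<Rightarrow> bool) \<Rightarrow> 'a list \<Rightarrow> bool" where
  "is_cycle E vs \<longleftrightarrow> length vs \<ge> 3 \<and> distinct vs \<and>
     (\<forall>i < length vs. E (vs ! i) (vs ! ((i + 1) mod length vs)))"

definition cycle_edge :: "'a list \<Rightarrow> 'a \<Rightarrow> 'a \<Rightarrow> bool" where
  "cycle_edge vs u v \<longleftrightarrow>
     (\<exists>i < length vs. {u, v} = {vs ! i, vs ! ((i + 1) mod length vs)})"

definition chords :: "('a \<Rightarrow> 'a \<Rightarrow> bool) \<Rightarrow> 'a list \<Rightarrow> 'a set set" where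
  "chords E vs = {{u, v} | u v. u \<in> set vs \<and> v \<in> set vs \<and> E u v \<and> \<not> cycle_edge vs u v}"

definition has_doubly_chorded_cycle :: "('a \<Rightarrow> 'a \<Rightarrow> bool) \<Rightarrow> bool" where
  "has_doubly_chorded_cycle E \<longleftrightarrow> (\<exists>vs. is_cycle E vs \<and> card (chords E vs) \<ge> 2)"

definition K11_part :: "nat \<Rightarrow> nat" where
  "K11_part i = (if i = 0 then 0 else if i = 1 then 1 else 2)"

definition K11 :: "nat \<Rightarrow> nat \<Rightarrow> nat \<Rightarrow> bool" where
  "K11 m i j \<longleftrightarrow> i < m + 2 \<and> j < m + 2 \<and> K11_part i \<noteq> K11_part j"

definition graph_iso :: "('a \<Rightarrow> 'a \<Rightarrow> bool) \<Rightarrow> ('b \<Rightarrow> 'b \<Rightarrow> bool) \<Rightarrow> 'b set \<Rightarrow> bool" where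
  "graph_iso E F W \<longleftrightarrow> (\<exists>f. bij_betw f UNIV W \<and> (\<forall>x y. E x y \<longleftrightarrow> F (f x) (f y)))"

end

theory Submission
  imports Defs "HOL-Analysis.Analysis"
begin

text \<open>A graph of minimum degree at least 3 has a doubly chorded cycle, so every set of \<open>k \<ge> 2\<close>
  vertices of a graph without doubly chorded cycles spans at most \<open>2k - 3\<close> edges. Let \<open>x\<close> be a
  nonnegative eigenvector for \<open>\<rho>\<close> whose largest entry is \<open>x\<^sub>u = 1\<close>, and write \<open>N\<close> for the
  neighbourhood of \<open>u\<close>, \<open>M\<close> for the non-isolated vertices of \<open>G[N]\<close> and \<open>W\<close> for the vertices
  outside \<open>N \<union> {u}\<close>. Evaluating \<open>(A\<^sup>2 - A) x\<close> at \<open>u\<close> gives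
  \<open>\<rho>\<^sup>2 - \<rho> \<le> |N| + 2 e(N) - |M| + e(N, W)\<close>. If \<open>M\<close> is nonempty, the edge bound on \<open>M \<union> {u}\<close> yields
  \<open>e(N) \<le> |M| - 1\<close>, and the edge bound on the whole graph turns this into \<open>\<rho>\<^sup>2 - \<rho> \<le> 2n - 4\<close>.
  Equality forces every vertex with entry 1 to be adjacent to all others, and there are two such
  vertices when \<open>n \<ge> 4\<close>.\<close>

subsection \<open>Doubly chorded cycles\<close>

lemma is_cycleI:
  assumes "length vs \<ge> 3" "distinct vs" "successively E vs" "E (last vs) (hd vs)"
  shows "is_cycle E vs"
  unfolding is_cycle_def
proof (intro conjI allI impI)
  fix i assume i: "i < length vs"
  show "E (vs ! i) (vs ! ((i + 1) mod length vs))"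
  proof (cases "Suc i < length vs")
    case True
    then show ?thesis using assms(3) by (simp add: successively_conv_nth)
  next
    case False
    then have "Suc i = length vs" using i by simp
    moreover have "vs \<noteq> []" using i by auto
    ultimately have "last vs = vs ! i" "hd vs = vs ! ((i + 1) mod length vs)"
      by (simp_all add: last_conv_nth hd_conv_nth flip: \<open>Suc i = length vs\<close>)
    then show ?thesis using assms(4) by simp
  qed
qed (use assms in auto)

text \<open>Distinctness turns equal vertex pairs into equal index pairs, and cyclically consecutive
  indices are either \<open>i\<close> and \<open>i + 1\<close> or the last and the first; the
  hypotheses exclude both.\<close>

lemma not_cycle_edge_nth:
  assumes "distinct vs" "Suc a < b" "b < length vs" "a \<noteq> 0 \<or> Suc b \<noteq> length vs"
  shows "\<not> cycle_edge vs (vs ! a) (vs ! b)"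
proof
  assume "cycle_edge vs (vs ! a) (vs ! b)"
  then obtain i where i: "i < length vs" "{vs ! a, vs ! b} = {vs ! i, vs ! ((i + 1) mod length vs)}"
    unfolding cycle_edge_def by blast
  have m: "(i + 1) mod length vs < length vs" using i by (intro mod_less_divisor) auto
  have "(a = i \<and> b = (i + 1) mod length vs) \<or> (b = i \<and> a = (i + 1) mod length vs)"
    using i m assms by (auto simp: doubleton_eq_iff nth_eq_iff_index_eq)
  then show False
    using assms i by (cases "Suc i = length vs") auto
qed

text \<open>Lets chords be exhibited by position alone: since each index pair is increasing and
  \<open>vs\<close> is distinct, different index pairs give different vertex pairs.\<close>

lemma doubly_chordedI:
  assumes "is_cycle E vs" "Suc a < b" "b < length vs" "a \<noteq> 0 \<or> Suc b \<noteq> length vs"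
    "Suc c < d" "d < length vs" "c \<noteq> 0 \<or> Suc d \<noteq> length vs"
    "E (vs ! a) (vs ! b)" "E (vs ! c) (vs ! d)" "(a, b) \<noteq> (c, d)"
  shows "has_doubly_chorded_cycle E"
proof -
  have dist: "distinct vs" using assms(1) by (simp add: is_cycle_def)
  have "chords E vs \<subseteq> Pow (set vs)" by (auto simp: chords_def)
  then have fin: "finite (chords E vs)" by (rule finite_subset) simp
  have chord: "{vs ! a, vs ! b} \<in> chords E vs"
    if "Suc a < b" "b < length vs" "a \<noteq> 0 \<or> Suc b \<noteq> length vs" "E (vs ! a) (vs ! b)" for a b
  proof -
    have "vs ! a \<in> set vs" "vs ! b \<in> set vs" using that by (auto intro: nth_mem)
    then show ?thesis
      using not_cycle_edge_nth[OF dist that(1-3)] that(4) unfolding chords_def by blast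
  qed
  have "{{vs ! a, vs ! b}, {vs ! c, vs ! d}} \<subseteq> chords E vs"
    using chord assms by simp
  moreover have "{vs ! a, vs ! b} \<noteq> {vs ! c, vs ! d}"
    using assms dist by (auto simp: doubleton_eq_iff nth_eq_iff_index_eq)
  ultimately have "card (chords E vs) \<ge> 2"
    using fin by (metis card_2_iff card_mono)
  then show ?thesis using assms(1) unfolding has_doubly_chorded_cycle_def by blast
qed

definition path_in :: "('a \<Rightarrow> 'a \<Rightarrow> bool) \<Rightarrow> 'a set \<Rightarrow> 'a list \<Rightarrow> bool" where
  "path_in E S p \<longleftrightarrow> p \<noteq> [] \<and> distinct p \<and> set p \<subseteq> S \<and> successively E p"

text \<open>Otherwise \<open>w # p\<close> would be a longer path inside \<open>S\<close>.\<close>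

lemma longest_path_hd_neighbours:
  assumes sym: "\<And>x y. E x y \<Longrightarrow> E y x"
    and "path_in E S p" "\<And>q. path_in E S q \<Longrightarrow> length q \<le> length p"
    and "E (hd p) w" "w \<in> S"
  shows "w \<in> set p"
proof (rule ccontr)
  assume "w \<notin> set p"
  then have "path_in E S (w # p)"
    using assms by (auto simp: path_in_def successively_Cons)
  then show False using assms(3) by fastforce
qed

text \<open>Let \<open>v\<^sub>0 v\<^sub>1 \<dots>\<close> be a longest path; \<open>v\<^sub>0\<close> is adjacent to \<open>v\<^sub>1\<close>, \<open>v\<^sub>i\<close> and \<open>v\<^sub>j\<close> with
  \<open>1 < i < j\<close>. The path obtained by reversing \<open>v\<^sub>0 \<dots> v\<^bsub>i-1\<^esub>\<close> is again longest, so a third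
  neighbour \<open>v\<^sub>m\<close> of \<open>v\<^bsub>i-1\<^esub>\<close> lies on it. If \<open>m \<le> j\<close> then the cycle \<open>v\<^sub>0 \<dots> v\<^sub>j\<close> has the chords
  \<open>v\<^sub>0 v\<^sub>i\<close> and \<open>v\<^bsub>i-1\<^esub> v\<^sub>m\<close>; otherwise \<open>v\<^bsub>i-1\<^esub> \<dots> v\<^sub>0 v\<^sub>i \<dots> v\<^sub>m\<close> has the chords
  \<open>v\<^bsub>i-1\<^esub> v\<^sub>i\<close> and \<open>v\<^sub>0 v\<^sub>j\<close>.\<close>

lemma min_degree_3_imp_doubly_chorded:
  fixes E :: "'a \<Rightarrow> 'a \<Rightarrow> bool"
  assumes sym: "\<And>x y. E x y \<Longrightarrow> E y x" and irr: "\<And>x. \<not> E x x"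
    and S: "finite S" "S \<noteq> {}" and deg: "\<And>v. v \<in> S \<Longrightarrow> card {w \<in> S. E v w} \<ge> 3"
  shows "has_doubly_chorded_cycle E"
proof -
  have third: "\<exists>w\<in>S. E v w \<and> w \<noteq> a \<and> w \<noteq> b" if "v \<in> S" for v a b
  proof (rule ccontr)
    assume "\<not> ?thesis"
    then have "{w \<in> S. E v w} \<subseteq> {a, b}" by auto
    then have "card {w \<in> S. E v w} \<le> card {a, b}" by (rule card_mono[rotated]) auto
    also have "\<dots> \<le> 2" by (simp add: card_insert_if)
    finally show False using deg[OF that] by simp
  qed
  obtain s where s: "s \<in> S" using S by auto
  have "length q < Suc (card S)" if "path_in E S q" for q
    using that S by (metis path_in_def card_mono distinct_card le_imp_less_Suc)
  moreover have "path_in E S [s]" using s by (simp add: path_in_def)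
  ultimately obtain p where p: "path_in E S p" and longest: "\<And>q. path_in E S q \<Longrightarrow> length q \<le> length p"
    using ex_has_greatest_nat[of "path_in E S" "[s]" length "Suc (card S)"] by blast
  have pne: "p \<noteq> []" and dist: "distinct p" and pS: "set p \<subseteq> S" and succ: "successively E p"
    using p by (auto simp: path_in_def)
  have succ': "E (p ! k) (p ! Suc k)" if "Suc k < length p" for k
    using succ that by (simp add: successively_conv_nth)
  have hd: "hd p = p ! 0" using pne by (simp add: hd_conv_nth)
  have p0S: "p ! 0 \<in> S" using pS pne by auto
  have nb0: "\<exists>k < length p. w = p ! k" if "E (p ! 0) w" "w \<in> S" for w
    using longest_path_hd_neighbours[of E S p w, OF sym p longest] that hd
    by (auto simp: in_set_conv_nth)
  obtain w where w: "w \<in> S" "E (p ! 0) w" "w \<noteq> p ! 1" using third[OF p0S] by blast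
  obtain w' where w': "w' \<in> S" "E (p ! 0) w'" "w' \<noteq> p ! 1" "w' \<noteq> w" using third[OF p0S] by blast
  obtain k k' where k: "k < length p" "w = p ! k" and k': "k' < length p" "w' = p ! k'"
    using nb0[OF w(2,1)] nb0[OF w'(2,1)] by blast
  have "k \<noteq> 0" "k' \<noteq> 0" using w w' k k' irr by (auto intro: ccontr)
  moreover have "k \<noteq> 1" "k' \<noteq> 1" "k \<noteq> k'" using w w' k k' by auto
  ultimately have kk: "1 < k" "1 < k'" "k \<noteq> k'" by auto
  obtain i j where ij: "1 < i" "i < j" "j < length p" "E (p ! 0) (p ! i)" "E (p ! 0) (p ! j)"
  proof (cases "k < k'")
    case True
    then show ?thesis using that[of k k'] w w' k k' kk by simp
  next
    case False
    then show ?thesis using that[of k' k] w w' k k' kk by simp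
  qed
  define q where "q = rev (take i p) @ drop i p"
  have lenq: "length q = length p" using ij by (simp add: q_def)
  have q_low: "q ! t = p ! (i - 1 - t)" if "t < i" for t
    using that ij by (simp add: q_def nth_append rev_nth)
  have q_high: "q ! t = p ! t" if "i \<le> t" "t < length p" for t
    using that ij by (simp add: q_def nth_append)
  have q_succ: "successively E q"
    unfolding successively_conv_nth
  proof (intro allI impI)
    fix t assume t: "Suc t < length q"
    consider "Suc t < i" | "Suc t = i" | "i \<le> t" by linarith
    then show "E (q ! t) (q ! Suc t)"
    proof cases
      case 1
      have "E (p ! (i - 1 - Suc t)) (p ! Suc (i - 1 - Suc t))" using 1 ij by (intro succ') auto
      moreover have "Suc (i - 1 - Suc t) = i - 1 - t" using 1 by auto
      ultimately show ?thesis using 1 q_low sym by (metis Suc_lessD)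
    next
      case 2
      then show ?thesis using q_low[of t] q_high[of "Suc t"] t lenq ij by auto
    next
      case 3
      then show ?thesis using q_high succ' t lenq by simp
    qed
  qed
  have q_dist: "distinct q"
    using dist by (simp add: q_def set_take_disj_set_drop_if_distinct)
  have "set q = set (take i p @ drop i p)" by (simp only: q_def set_append set_rev)
  then have q_set: "set q = set p" by simp
  have q_path: "path_in E S q" using q_dist q_set q_succ pS pne by (auto simp: path_in_def)
  have hdq: "hd q = p ! (i - 1)"
  proof -
    have "q \<noteq> []" using lenq pne by auto
    then show ?thesis using q_low[of 0] ij by (simp add: hd_conv_nth)
  qed
  have "p ! (i - 1) \<in> S" using pS ij by auto
  then obtain z where z: "z \<in> S" "E (p ! (i - 1)) z" "z \<noteq> p ! i" "z \<noteq> p ! (i - 2)"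
    using third by blast
  have "z \<in> set q"
    using longest_path_hd_neighbours[of E S q z, OF sym q_path] longest lenq z hdq by auto
  then obtain m where m: "m < length p" "z = p ! m" using q_set by (metis in_set_conv_nth)
  \<comment> \<open>Positions \<open>m\<close> and \<open>i - 1\<close> are therefore neither equal
    nor consecutive, so the edge from \<open>p ! (i - 1)\<close> to \<open>z\<close> is a chord of
    the first cycle below.\<close>
  have mne: "m \<noteq> i" "m \<noteq> i - 1" "m \<noteq> i - 2" using z m irr by auto
  show ?thesis
  proof (cases "m \<le> j")
    case True
    define c where "c = take (Suc j) p"
    have c: "length c = Suc j" "\<And>t. t \<le> j \<Longrightarrow> c ! t = p ! t"
      using ij by (auto simp: c_def)
    have "last c = p ! j" "hd c = p ! 0" using c by (simp_all add: last_conv_nth hd_conv_nth flip: length_greater_0_conv)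
    then have cyc: "is_cycle E c"
      using ij c dist succ' sym by (intro is_cycleI) (auto simp: c_def successively_conv_nth)
    have e1: "E (c ! 0) (c ! i)" using c ij by simp
    have e2: "E (c ! (i - 1)) (c ! m)" using c ij True z m by simp
    show ?thesis
    proof (cases "m < i")
      case True
      have "Suc m < i - 1" using True mne ij by auto
      then show ?thesis
        by (intro doubly_chordedI[OF cyc, of 0 i m "i - 1"]) (use e1 sym[OF e2] c(1) ij in auto)
    next
      case False
      then have "Suc (i - 1) < m" using mne ij by auto
      then show ?thesis
        by (intro doubly_chordedI[OF cyc, of 0 i "i - 1" m])
          (use e1 e2 c(1) ij \<open>m \<le> j\<close> in auto)
    qed
  next
    case False
    define c where "c = take (Suc m) q"
    have c: "length c = Suc m" "\<And>t. t \<le> m \<Longrightarrow> c ! t = q ! t"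
      using m lenq by (auto simp: c_def)
    have "last c = p ! m" "hd c = p ! (i - 1)" using c q_high[of m] q_low[of 0] False m ij
      by (simp_all add: last_conv_nth hd_conv_nth flip: length_greater_0_conv)
    moreover have "successively E c"
      using q_succ lenq m c by (simp add: c_def successively_conv_nth)
    ultimately have cyc: "is_cycle E c"
      using c q_dist z m sym False ij by (intro is_cycleI) (auto simp: c_def)
    have "E (p ! (i - 1)) (p ! i)" using succ'[of "i - 1"] ij by simp
    then have e1: "E (c ! 0) (c ! i)" using c ij False q_low[of 0] q_high[of i] by simp
    have e2: "E (c ! (i - 1)) (c ! j)" using c ij False q_low[of "i - 1"] q_high[of j] by simp
    show ?thesis
      by (intro doubly_chordedI[OF cyc, of 0 i "i - 1" j]) (use e1 e2 c(1) ij False in auto)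
  qed
qed

subsection \<open>Counting edges and the bound on the spectral radius\<close>

definition deg :: "('a \<Rightarrow> 'a \<Rightarrow> bool) \<Rightarrow> 'a set \<Rightarrow> 'a \<Rightarrow> real" where
  "deg E S v = (\<Sum>w\<in>S. adj E v w)"

text \<open>The number of ordered adjacent pairs, so edges inside a set are counted twice by
  \<open>darts E S S\<close>.\<close>
definition darts :: "('a \<Rightarrow> 'a \<Rightarrow> bool) \<Rightarrow> 'a set \<Rightarrow> 'a set \<Rightarrow> real" where
  "darts E A B = (\<Sum>v\<in>A. deg E B v)"

lemma deg_nonneg: "deg E S v \<ge> 0"
  by (auto simp: deg_def adj_def intro: sum_nonneg)

lemma darts_nonneg: "darts E A B \<ge> 0"
  by (auto simp: darts_def deg_nonneg intro: sum_nonneg)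

lemma deg_eq_card: "finite S \<Longrightarrow> deg E S v = real (card {w \<in> S. E v w})"
  by (simp add: deg_def adj_def sum.If_cases Int_def)

lemma darts_Un_left:
  "finite A \<Longrightarrow> finite A' \<Longrightarrow> A \<inter> A' = {} \<Longrightarrow> darts E (A \<union> A') B = darts E A B + darts E A' B"
  by (simp add: darts_def sum.union_disjoint)

lemma darts_Un_right:
  "finite B \<Longrightarrow> finite B' \<Longrightarrow> B \<inter> B' = {} \<Longrightarrow> darts E A (B \<union> B') = darts E A B + darts E A B'"
  by (simp add: darts_def deg_def sum.union_disjoint sum.distrib)

lemma darts_eq_0: "(\<And>v w. v \<in> A \<Longrightarrow> w \<in> B \<Longrightarrow> \<not> E v w) \<Longrightarrow> darts E A B = 0"
  by (simp add: darts_def deg_def adj_def)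

lemma darts_commute:
  assumes "\<And>x y. E x y \<Longrightarrow> E y x"
  shows "darts E A B = darts E B A"
proof -
  have "adj E v w = adj E w v" for v w using assms by (auto simp: adj_def)
  then show ?thesis unfolding darts_def deg_def by (subst sum.swap) simp
qed

lemma darts_insert:
  assumes "\<And>x y. E x y \<Longrightarrow> E y x" "\<And>x. \<not> E x x" "finite S" "v \<notin> S"
  shows "darts E (insert v S) (insert v S) = darts E S S + 2 * deg E S v"
proof -
  have "darts E ({v} \<union> S) ({v} \<union> S) = darts E {v} {v} + darts E S {v} + (darts E {v} S + darts E S S)"
    using assms by (subst darts_Un_right; simp add: darts_Un_left del: Un_insert_left)
  moreover have "darts E {v} {v} = 0" using assms by (intro darts_eq_0) auto
  moreover have "darts E S {v} = darts E {v} S" using assms by (intro darts_commute)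
  ultimately show ?thesis by (simp add: darts_def)
qed

text \<open>Some vertex has at most two neighbours in \<open>S\<close>, by the minimum degree
  result. Deleting it loses at most 4 darts, which is the slope of the bound; two vertices carry at
  most 2 darts.\<close>

lemma darts_self_le:
  fixes E :: "'a \<Rightarrow> 'a \<Rightarrow> bool"
  assumes sym: "\<And>x y. E x y \<Longrightarrow> E y x" and irr: "\<And>x. \<not> E x x"
    and free: "\<not> has_doubly_chorded_cycle E" and "finite S" "card S \<ge> 2"
  shows "darts E S S \<le> 4 * real (card S) - 6"
  using assms(4,5)
proof (induction "card S" arbitrary: S rule: less_induct)
  case less
  have "S \<noteq> {}" using less.prems by auto
  show ?case
  proof (cases "card S = 2")
    case True
    then obtain a b where "S = {a, b}" "a \<noteq> b" by (meson card_2_iff)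
    then show ?thesis using irr by (simp add: darts_def deg_def adj_def)
  next
    case False
    obtain v where v: "v \<in> S" "card {w \<in> S. E v w} < 3"
      using min_degree_3_imp_doubly_chorded[of E S] sym irr free less.prems \<open>S \<noteq> {}\<close>
      by (meson not_le)
    define T where "T = S - {v}"
    have T: "S = insert v T" "v \<notin> T" "finite T" using v less.prems by (auto simp: T_def)
    have cT: "card S = Suc (card T)" using T by simp
    have "darts E T T \<le> 4 * real (card T) - 6"
      using less.hyps[of T] cT T False less.prems by simp
    moreover have "deg E T v \<le> 2"
    proof -
      have "card {w \<in> T. E v w} \<le> card {w \<in> S. E v w}"
        using less.prems by (intro card_mono) (auto simp: T_def)
      then show ?thesis using v T by (simp add: deg_eq_card)
    qed
    moreover have "darts E S S = darts E T T + 2 * deg E T v"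
      unfolding T(1) using T sym irr by (intro darts_insert) auto
    ultimately show ?thesis using cT by simp
  qed
qed

section \<open>The quadratic inequality at a vertex with entry 1\<close>

text \<open>A vertex with entry 1 is deliberately not fixed here: the equality analysis applies the
  results to several such vertices.\<close>

locale dcc_free_eigenvector =
  fixes E :: "'a::finite \<Rightarrow> 'a \<Rightarrow> bool" and x :: "'a \<Rightarrow> real" and \<rho> :: real
  assumes sym: "E v w \<Longrightarrow> E w v" and irr: "\<not> E v v"
    and free: "\<not> has_doubly_chorded_cycle E"
    and card: "CARD('a) \<ge> 3"
    and eigen: "(\<Sum>w\<in>UNIV. adj E v w * x w) = \<rho> * x v"
    and nonneg: "0 \<le> x v" and le1: "x v \<le> 1"
begin

abbreviation N :: "'a \<Rightarrow> 'a set" where "N u \<equiv> {v. E u v}"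
abbreviation W :: "'a \<Rightarrow> 'a set" where "W u \<equiv> {v. v \<noteq> u \<and> \<not> E u v}"
abbreviation M :: "'a \<Rightarrow> 'a set" where "M u \<equiv> {v \<in> N u. \<exists>w \<in> N u. E v w}"
abbreviation I :: "'a \<Rightarrow> 'a set" where "I u \<equiv> {v \<in> N u. \<forall>w \<in> N u. \<not> E v w}"

lemma adj_sum: "(\<Sum>w\<in>UNIV. adj E v w * f w) = (\<Sum>w\<in>N v. f w)"
  by (simp add: adj_def if_distrib[of "\<lambda>t. t * _"] sum.If_cases cong: if_cong)

lemma eigen_N: "(\<Sum>w\<in>N v. x w) = \<rho> * x v"
  using eigen adj_sum by simp

lemma UNIV_split: "(UNIV :: 'a set) = insert u (N u \<union> W u)"
  by auto

lemma rho_nonneg: "x u = 1 \<Longrightarrow> 0 \<le> \<rho>"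
  using eigen_N[of u] nonneg by (metis mult.right_neutral sum_nonneg)

text \<open>Counts walks of length two from \<open>u\<close>: \<open>deg E (N u) w\<close> of them
  end at \<open>w\<close>, and \<open>card (N u)\<close> return to \<open>u\<close>. Subtracting
  \<open>\<rho>\<close>, the sum of the entries over \<open>N u\<close>, produces the
  \<open>- 1\<close>.\<close>

lemma rho_square_minus_rho:
  assumes "x u = 1"
  shows "\<rho>\<^sup>2 - \<rho> = card (N u) + (\<Sum>w\<in>N u. (deg E (N u) w - 1) * x w)
    + (\<Sum>w\<in>W u. deg E (N u) w * x w)"
proof -
  have rho: "\<rho> = (\<Sum>w\<in>N u. x w)" using eigen_N[of u] assms by simp
  have "\<rho>\<^sup>2 = (\<Sum>v\<in>N u. \<rho> * x v)"
    by (simp add: power2_eq_square rho flip: sum_distrib_left)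
  also have "\<dots> = (\<Sum>v\<in>N u. \<Sum>w\<in>UNIV. adj E v w * x w)" by (simp add: eigen)
  also have "\<dots> = (\<Sum>w\<in>UNIV. \<Sum>v\<in>N u. adj E v w * x w)" by (rule sum.swap)
  also have "\<dots> = (\<Sum>w\<in>UNIV. deg E (N u) w * x w)"
    unfolding deg_def sum_distrib_right by (auto simp: adj_def sym intro!: sum.cong)
  also have "\<dots> = deg E (N u) u * x u + (\<Sum>w\<in>N u \<union> W u. deg E (N u) w * x w)"
    unfolding UNIV_split[of u] by (subst sum.insert) (auto simp: irr)
  also have "(\<Sum>w\<in>N u \<union> W u. deg E (N u) w * x w)
    = (\<Sum>w\<in>N u. deg E (N u) w * x w) + (\<Sum>w\<in>W u. deg E (N u) w * x w)"
    by (rule sum.union_disjoint) auto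
  also have "deg E (N u) u * x u = card (N u)" using assms by (simp add: deg_eq_card)
  finally show ?thesis
    by (subst (2) rho) (simp add: left_diff_distrib sum_subtractf)
qed

lemma darts_UNIV:
  "darts E UNIV UNIV = 2 * card (N u) + darts E (N u) (N u) + 2 * darts E (W u) (N u) + darts E (W u) (W u)"
proof -
  let ?R = "N u \<union> W u"
  have "darts E UNIV UNIV = darts E ?R ?R + 2 * deg E ?R u"
    unfolding UNIV_split[of u] using sym irr by (intro darts_insert) auto
  moreover have "{w \<in> ?R. E u w} = N u" by auto
  then have "deg E ?R u = card (N u)" by (simp add: deg_eq_card)
  moreover have "darts E ?R ?R = darts E (N u) (N u) + darts E (W u) (N u) + (darts E (N u) (W u) + darts E (W u) (W u))"
    by (subst darts_Un_right; (subst darts_Un_left)?) (auto simp: darts_Un_left Int_def)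
  moreover have "darts E (N u) (W u) = darts E (W u) (N u)" using sym by (intro darts_commute)
  ultimately show ?thesis by simp
qed

lemma darts_UNIV_le: "darts E UNIV UNIV \<le> 4 * real CARD('a) - 6"
  using darts_self_le[of E UNIV] sym irr free card by simp

lemma darts_M_N: "darts E (M u) (N u) = darts E (N u) (N u)"
proof -
  have "darts E (M u \<union> I u) (N u) = darts E (M u) (N u) + darts E (I u) (N u)"
    by (rule darts_Un_left) auto
  moreover have "darts E (I u) (N u) = 0" by (rule darts_eq_0) auto
  moreover have "M u \<union> I u = N u" by auto
  ultimately show ?thesis by simp
qed

text \<open>The edge bound applied to the graph induced on \<open>u\<close> and the non-isolated vertices of its
  neighbourhood.\<close>
lemma darts_N_le:
  assumes "M u \<noteq> {}"
  shows "darts E (N u) (N u) \<le> 2 * real (card (M u)) - 2"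
proof -
  have u: "u \<notin> M u" using irr by auto
  have "darts E (M u) (N u) = darts E (M u) (M u) + darts E (M u) (I u)"
  proof -
    have "M u \<union> I u = N u" by auto
    then show ?thesis using darts_Un_right[of "M u" "I u" E "M u"] by force
  qed
  moreover have "darts E (M u) (I u) = 0" by (rule darts_eq_0) (use sym in auto)
  ultimately have NM: "darts E (N u) (N u) = darts E (M u) (M u)" using darts_M_N by simp
  have "deg E (M u) u = card (M u)" by (simp add: deg_eq_card conj_commute conj_left_commute cong: conj_cong)
  then have "darts E (insert u (M u)) (insert u (M u)) = darts E (M u) (M u) + 2 * card (M u)"
    using darts_insert[of E "M u" u] sym irr u by auto
  moreover have "card (insert u (M u)) = Suc (card (M u))" using u by (intro card_insert_disjoint) auto
  moreover have "card (M u) \<ge> 1" using assms by (simp add: Suc_le_eq card_gt_0_iff)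
  ultimately show ?thesis
    using darts_self_le[of E "insert u (M u)"] sym irr free NM by simp
qed

lemma deg_M: "v \<in> M u \<Longrightarrow> deg E (N u) v \<ge> 1"
  by (auto simp: deg_eq_card Suc_le_eq card_gt_0_iff)

text \<open>The loss in the bound as an exact identity. All six terms are nonnegative when
  \<open>M u\<close> is nonempty, so the same formula yields the inequality and, when the left side
  is 0, the vanishing of every term.\<close>

lemma rho_slack:
  assumes "x u = 1"
  shows "2 * real CARD('a) - 4 - (\<rho>\<^sup>2 - \<rho>) =
    (\<Sum>w\<in>M u. (deg E (N u) w - 1) * (1 - x w)) + (\<Sum>w\<in>I u. x w)
    + (\<Sum>w\<in>W u. deg E (N u) w * (1 - x w))
    + (real (card (M u)) - 1 - darts E (N u) (N u) / 2)
    + darts E (W u) (W u) / 2 + (2 * real CARD('a) - 3 - darts E UNIV UNIV / 2)"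
proof -
  have MI: "M u \<union> I u = N u" by auto
  have "(\<Sum>w\<in>M u \<union> I u. (deg E (N u) w - 1) * x w)
      = (\<Sum>w\<in>M u. (deg E (N u) w - 1) * x w) + (\<Sum>w\<in>I u. (deg E (N u) w - 1) * x w)"
    by (rule sum.union_disjoint) auto
  moreover have "deg E (N u) w = 0" if "w \<in> I u" for w
    using that by (auto simp: deg_def adj_def)
  then have "(\<Sum>w\<in>I u. (deg E (N u) w - 1) * x w) = (\<Sum>w\<in>I u. - x w)"
    by (intro sum.cong) auto
  moreover have "(\<Sum>w\<in>M u. (deg E (N u) w - 1) * (1 - x w))
    = darts E (N u) (N u) - card (M u) - (\<Sum>w\<in>M u. (deg E (N u) w - 1) * x w)"
    unfolding darts_M_N[symmetric] by (simp add: darts_def right_diff_distrib sum_subtractf)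
  moreover have "(\<Sum>w\<in>W u. deg E (N u) w * (1 - x w))
    = darts E (W u) (N u) - (\<Sum>w\<in>W u. deg E (N u) w * x w)"
    by (simp add: darts_def right_diff_distrib sum_subtractf)
  ultimately show ?thesis
    using rho_square_minus_rho[OF assms] darts_UNIV[of u] MI by (simp add: sum_negf field_simps)
qed

lemma rho_slack_nonneg:
  "0 \<le> (\<Sum>w\<in>M u. (deg E (N u) w - 1) * (1 - x w))"
  "0 \<le> (\<Sum>w\<in>I u. x w)"
  "0 \<le> (\<Sum>w\<in>W u. deg E (N u) w * (1 - x w))"
proof -
  show "0 \<le> (\<Sum>w\<in>M u. (deg E (N u) w - 1) * (1 - x w))"
    using deg_M[of _ u] le1 by (intro sum_nonneg mult_nonneg_nonneg) (simp_all only: diff_ge_0_iff_ge)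
qed (use le1 nonneg in \<open>auto intro!: sum_nonneg mult_nonneg_nonneg deg_nonneg\<close>)

text \<open>If \<open>N u\<close> is independent, the negative terms sum to \<open>-\<rho>\<close> and \<open>\<rho>\<^sup>2\<close> is bounded by the
  number of edges.\<close>
lemma rho_less_if_independent:
  assumes "x u = 1" "M u = {}"
  shows "\<rho>\<^sup>2 - \<rho> < 2 * real CARD('a) - 4"
proof -
  have "I u = N u" using assms(2) by auto
  then have "(\<Sum>w\<in>I u. x w) = \<rho>" using eigen_N[of u] assms by simp
  moreover have "darts E (N u) (N u) = 0" using assms(2) by (intro darts_eq_0) auto
  moreover have "(\<Sum>w\<in>M u. (deg E (N u) w - 1) * (1 - x w)) = 0" "card (M u) = 0"
    by (simp_all only: assms(2) sum.empty card.empty)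
  \<comment> \<open>With \<open>M u\<close> empty the fourth term of the slack is -1, hence 3 in
    place of 4.\<close>
  ultimately have "\<rho>\<^sup>2 \<le> 2 * real CARD('a) - 3"
    using rho_slack[OF assms(1)] rho_slack_nonneg(3)[of u] darts_nonneg[of E "W u" "W u"] darts_UNIV_le
    by linarith
  \<comment> \<open>For \<open>\<rho> > 1\<close>, subtracting \<open>\<rho>\<close> from the last
    bound removes more than the missing 1; for \<open>\<rho> \<le> 1\<close> the left side is at
    most 0, while \<open>2n - 4\<close> is positive.\<close>
  moreover have "\<rho>\<^sup>2 - \<rho> \<le> 0" if "\<rho> \<le> 1"
    using that rho_nonneg[OF assms(1)] by (simp add: power2_eq_square mult_left_le)
  ultimately show ?thesis using card by (cases "\<rho> \<le> 1") auto
qed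

lemma rho_le:
  assumes "x u = 1"
  shows "\<rho>\<^sup>2 - \<rho> \<le> 2 * real CARD('a) - 4"
proof (cases "M u = {}")
  case True
  then show ?thesis using rho_less_if_independent[OF assms] by simp
next
  case False
  then show ?thesis
    using rho_slack[OF assms] rho_slack_nonneg[of u] darts_nonneg[of E "W u" "W u"] darts_UNIV_le darts_N_le[OF False]
    by linarith
qed

section \<open>Structure of the graph in the case of equality\<close>

text \<open>Equality makes every term of \<open>rho_slack\<close> vanish, and so every summand in
  its sums. A vertex of \<open>I u\<close> would then have entry 0, forcing all its neighbours,
  including \<open>u\<close>, to have entry 0.\<close>

lemma extremal_vertex:
  assumes u: "x u = 1" and eq: "\<rho>\<^sup>2 - \<rho> = 2 * real CARD('a) - 4"
  shows "M u = N u" "N u \<noteq> {}"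
    and "\<And>v w. v \<in> W u \<Longrightarrow> w \<in> W u \<Longrightarrow> \<not> E v w"
    and "\<And>v. v \<in> N u \<Longrightarrow> deg E (N u) v > 1 \<Longrightarrow> x v = 1"
    and "\<And>w. w \<in> W u \<Longrightarrow> deg E (N u) w > 0 \<Longrightarrow> x w = 1"
    and "darts E (N u) (N u) = 2 * real (card (N u)) - 2"
    and "darts E UNIV UNIV = 4 * real CARD('a) - 6"
proof -
  have M: "M u \<noteq> {}" using rho_less_if_independent[OF u] eq by (metis less_irrefl)
  have zero: "(\<Sum>w\<in>M u. (deg E (N u) w - 1) * (1 - x w)) = 0" "(\<Sum>w\<in>I u. x w) = 0"
    "(\<Sum>w\<in>W u. deg E (N u) w * (1 - x w)) = 0"
    "real (card (M u)) - 1 - darts E (N u) (N u) / 2 = 0"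
    "darts E (W u) (W u) = 0" "2 * real CARD('a) - 3 - darts E UNIV UNIV / 2 = 0"
    using rho_slack[OF u] rho_slack_nonneg[of u] darts_nonneg[of E "W u" "W u"] darts_UNIV_le darts_N_le[OF M] eq
    by linarith+
  have "v \<notin> I u" for v
  proof
    assume v: "v \<in> I u"
    then have "x v = 0" using zero(2) nonneg by (subst (asm) sum_nonneg_eq_0_iff) auto
    then have "(\<Sum>w\<in>N v. x w) = 0" using eigen_N[of v] by simp
    moreover have "u \<in> N v" using v sym by auto
    ultimately have "x u = 0" using nonneg by (subst (asm) sum_nonneg_eq_0_iff) auto
    then show False using u by simp
  qed
  then show MN: "M u = N u" by auto
  show "N u \<noteq> {}" using M by auto
  show "x v = 1" if "v \<in> N u" "deg E (N u) v > 1" for v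
  proof -
    have "v \<in> M u" using that(1) MN by simp
    moreover have "\<And>w. w \<in> M u \<Longrightarrow> 0 \<le> (deg E (N u) w - 1) * (1 - x w)"
      using deg_M[of _ u] le1 by (intro mult_nonneg_nonneg) (simp_all only: diff_ge_0_iff_ge)
    ultimately have "(deg E (N u) v - 1) * (1 - x v) = 0"
      using zero(1) sum_nonneg_eq_0_iff[of "M u" "\<lambda>w. (deg E (N u) w - 1) * (1 - x w)"] by fastforce
    then show ?thesis using that(2) by simp
  qed
  show "x w = 1" if "w \<in> W u" "deg E (N u) w > 0" for w
  proof -
    have "\<And>w. 0 \<le> deg E (N u) w * (1 - x w)"
      using deg_nonneg le1 by (intro mult_nonneg_nonneg) simp_all
    then have "deg E (N u) w * (1 - x w) = 0"
      using zero(3) sum_nonneg_eq_0_iff[of "W u" "\<lambda>w. deg E (N u) w * (1 - x w)"] that(1) by fastforce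
    then show ?thesis using that(2) by simp
  qed
  show "\<not> E v w" if "v \<in> W u" "w \<in> W u" for v w
  proof -
    have "deg E (W u) v = 0"
      using zero(5) that(1) sum_nonneg_eq_0_iff[of "W u" "deg E (W u)"] deg_nonneg[of E "W u"]
      unfolding darts_def by fastforce
    then show ?thesis using that(2) by (auto simp: deg_eq_card)
  qed
  show "darts E (N u) (N u) = 2 * real (card (N u)) - 2" using zero(4) MN by simp
  show "darts E UNIV UNIV = 4 * real CARD('a) - 6" using zero(6) by simp
qed

text \<open>The pentagon \<open>a b c d e\<close> has the chords \<open>a c\<close> and
  \<open>b d\<close>.\<close>

lemma doubly_chorded_five:
  assumes "distinct [a, b, c, d, e]" "E a b" "E b c" "E c d" "E d e" "E e a" "E a c" "E b d"
  shows False
proof -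
  have "is_cycle E [a, b, c, d, e]" using assms by (intro is_cycleI) auto
  then have "has_doubly_chorded_cycle E"
    using assms by (intro doubly_chordedI[of E "[a, b, c, d, e]" 0 2 1 3]) auto
  then show False using free by simp
qed

text \<open>A \<open>K_4\<close> is a 4-cycle with both diagonals.\<close>

lemma doubly_chorded_four:
  assumes "distinct [a, b, c, d]" "E a b" "E b c" "E c d" "E d a" "E a c" "E b d"
  shows False
proof -
  have "is_cycle E [a, b, c, d]" using assms by (intro is_cycleI) auto
  then have "has_doubly_chorded_cycle E"
    using assms by (intro doubly_chordedI[of E "[a, b, c, d]" 0 2 1 3]) auto
  then show False using free by simp
qed

text \<open>A vertex \<open>w\<close> not adjacent to \<open>u\<close> turns out to have entry 1 as
  well, so it lies in a triangle \<open>w c d\<close>. All neighbours of \<open>w\<close> are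
  neighbours of \<open>u\<close>, and a third one would close a doubly chorded pentagon through
  \<open>u\<close>. Hence \<open>\<rho> \<le> 2\<close>, too small for
  \<open>n \<ge> 4\<close>.\<close>

lemma extremal_vertex_universal:
  assumes u: "x u = 1" and eq: "\<rho>\<^sup>2 - \<rho> = 2 * real CARD('a) - 4" and "w \<noteq> u"
  shows "E u w"
proof (rule ccontr)
  assume "\<not> E u w"
  then have w: "w \<in> W u" using assms by simp
  note ext = extremal_vertex[OF u eq]
  have sub: "E u v" if "E w v" for v
  proof (rule ccontr)
    assume "\<not> E u v"
    moreover have "v \<noteq> u" using that sym \<open>\<not> E u w\<close> by auto
    ultimately show False using ext(3)[OF w, of v] that by simp
  qed
  obtain a where "a \<in> M u" using ext(1,2) by auto
  then obtain b where ab: "E u a" "E u b" "E a b" by auto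
  have "u \<noteq> a" "u \<noteq> b" "a \<noteq> b" "w \<noteq> a" "w \<noteq> b" using ab irr \<open>\<not> E u w\<close> by metis+
  then have "card {u, w, a, b} = 4" using \<open>w \<noteq> u\<close> by simp
  then have n4: "CARD('a) \<ge> 4" by (metis card_mono finite top_greatest)
  \<comment> \<open>An isolated \<open>w\<close> could be deleted without losing darts, and the
    remaining \<open>n - 1\<close> vertices would exceed their edge bound.\<close>
  have "deg E (N u) w \<noteq> 0"
  proof
    assume "deg E (N u) w = 0"
    then have "\<not> E w v" for v using sub by (auto simp: deg_eq_card)
    then have "deg E (UNIV - {w}) w = 0" by (auto simp: deg_eq_card)
    moreover have "insert w (UNIV - {w}) = UNIV" by auto
    then have "darts E UNIV UNIV = darts E (UNIV - {w}) (UNIV - {w}) + 2 * deg E (UNIV - {w}) w"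
      using darts_insert[of E "UNIV - {w}" w] sym irr by auto
    moreover have "darts E (UNIV - {w}) (UNIV - {w}) \<le> 4 * real (card (UNIV - {w})) - 6"
      by (rule darts_self_le) (use sym irr free n4 in auto)
    moreover have "real (card (UNIV - {w})) = real CARD('a) - 1" using n4 by simp
    ultimately show False using ext(7) by linarith
  qed
  then have xw: "x w = 1" using ext(5)[OF w] deg_nonneg[of E "N u" w] by linarith
  obtain c where "c \<in> M w" using extremal_vertex(1,2)[OF xw eq] by auto
  then obtain d where cd: "E w c" "E w d" "E c d" by auto
  have "N w \<subseteq> {c, d}"
  proof
    fix e assume e: "e \<in> N w"
    show "e \<in> {c, d}"
    proof (rule ccontr)
      assume "e \<notin> {c, d}"
      moreover have "u \<noteq> c" "u \<noteq> d" "u \<noteq> e" "c \<noteq> d" "c \<noteq> w" "d \<noteq> w" "w \<noteq> e"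
        using cd e sub irr \<open>\<not> E u w\<close> by (metis mem_Collect_eq)+
      ultimately have "distinct [u, c, d, w, e]" using \<open>w \<noteq> u\<close> by auto
      then show False
        by (rule doubly_chorded_five) (use cd e sub sym in auto)
    qed
  qed
  then have "(\<Sum>v\<in>N w. x v) \<le> (\<Sum>v\<in>{c, d}. x v)" using nonneg by (intro sum_mono2) auto
  also have "\<dots> \<le> 2" using le1[of c] le1[of d] cd irr by (cases "c = d") auto
  finally have "\<rho> \<le> 2" using eigen_N[of w] xw by simp
  \<comment> \<open>The product equals \<open>2 - (\<rho>\<^sup>2 - \<rho>)\<close>, whereas
    equality gives \<open>\<rho>\<^sup>2 - \<rho> \<ge> 4\<close>.\<close>
  then have "(2 - \<rho>) * (\<rho> + 1) \<ge> 0" using rho_nonneg[OF u] by simp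
  then show False using eq n4 by (simp add: power2_eq_square algebra_simps)
qed

text \<open>A second universal vertex \<open>v\<close> is found inside \<open>N u\<close>. Two
  adjacent vertices outside \<open>{u, v}\<close> would then span a \<open>K_4\<close> with
  \<open>u\<close> and \<open>v\<close>.\<close>

lemma extremal_structure:
  assumes u: "x u = 1" and eq: "\<rho>\<^sup>2 - \<rho> = 2 * real CARD('a) - 4"
  obtains v where "v \<noteq> u" "\<And>a b. E a b \<longleftrightarrow> a \<noteq> b \<and> (a \<in> {u, v} \<or> b \<in> {u, v})"
proof -
  note ext = extremal_vertex[OF u eq]
  have univ_u: "E u w" if "w \<noteq> u" for w using extremal_vertex_universal[OF u eq that] .
  have N: "N u = UNIV - {u}" using univ_u irr by auto
  have "\<exists>v. v \<noteq> u \<and> (\<forall>w. w \<noteq> v \<longrightarrow> E v w)"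
  proof (cases "\<exists>v\<in>N u. deg E (N u) v > 1")
    case True
    then obtain v where v: "v \<in> N u" "x v = 1" using ext(4) by blast
    have "v \<noteq> u" using v(1) N by auto
    then show ?thesis using extremal_vertex_universal[OF v(2) eq] by blast
  next
    case False
    \<comment> \<open>All degrees in \<open>N u\<close> are at most 1, so the exact dart count
      \<open>2 * card (N u) - 2\<close> leaves at most two neighbours. The graph is then a triangle,
      the case \<open>n = 3\<close>.\<close>
    then have "darts E (N u) (N u) \<le> (\<Sum>v\<in>N u. 1)"
      unfolding darts_def by (intro sum_mono) (auto simp: not_less)
    then have c2: "card (N u) \<le> 2" using ext(6) by simp
    obtain a where "a \<in> M u" using ext(1,2) by auto
    then obtain b where ab: "a \<in> N u" "b \<in> N u" "E a b" by auto
    have "a \<noteq> b" using ab(3) irr by (cases "a = b") auto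
    then have "{a, b} = N u" using ab c2 by (intro card_seteq) auto
    then have "w \<in> {u, a, b}" for w using N by blast
    then have "w = u \<or> w = b" if "w \<noteq> a" for w using that by blast
    then have "E a w" if "w \<noteq> a" for w using that ab sym[of u a] by blast
    moreover have "a \<noteq> u" using ab N by auto
    ultimately show ?thesis by blast
  qed
  then obtain v where v: "v \<noteq> u" "\<And>w. w \<noteq> v \<Longrightarrow> E v w" by blast
  have "\<not> E a b" if "a \<notin> {u, v}" "b \<notin> {u, v}" for a b
  proof
    assume "E a b"
    moreover have "a \<noteq> b" using \<open>E a b\<close> irr by (cases "a = b") auto
    ultimately show False
      using that v univ_u sym[of u b] sym[of v a]
      by (intro doubly_chorded_four[of u a v b]) auto
  qed
  then have "E a b \<longleftrightarrow> a \<noteq> b \<and> (a \<in> {u, v} \<or> b \<in> {u, v})" for a b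
    using univ_u[of a] univ_u[of b] v(2)[of a] v(2)[of b] sym[of u a] sym[of v a] irr[of a]
    by (cases "a = b") auto
  then show ?thesis using that v(1) by blast
qed

end

section \<open>The complete tripartite graph with parts 1, 1, n - 2\<close>

text \<open>The isomorphism sends \<open>u\<close> and \<open>v\<close> to the singleton parts 0 and
  1, and the other vertices bijectively to the large part.\<close>

lemma graph_iso_K11I:
  fixes E :: "'a::finite \<Rightarrow> 'a \<Rightarrow> bool"
  assumes "v \<noteq> u" and E: "\<And>a b. E a b \<longleftrightarrow> a \<noteq> b \<and> (a \<in> {u, v} \<or> b \<in> {u, v})"
  shows "graph_iso E (K11 (CARD('a) - 2)) {0..<CARD('a)}"
proof -
  have "card {u, v} \<le> CARD('a)" by (rule card_mono) auto
  then have n: "CARD('a) \<ge> 2" using assms(1) by simp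
  have "card (UNIV - {u, v}) = card {2..<CARD('a)}"
    using assms(1) by (subst card_Diff_subset) auto
  then obtain g where g: "bij_betw g (UNIV - {u, v}) {2..<CARD('a)}"
    using finite_same_card_bij[of "UNIV - {u, v}" "{2..<CARD('a)}"] by auto
  define f where "f = (\<lambda>a. if a = u then 0 else if a = v then 1 else g a)"
  have "bij_betw f (UNIV - {u, v}) {2..<CARD('a)}"
    using g by (rule iffD1[OF bij_betw_cong, rotated]) (auto simp: f_def)
  moreover have "bij_betw f {u, v} {0, 1}"
    using assms(1) by (auto simp: bij_betw_def f_def)
  ultimately have "bij_betw f ({u, v} \<union> (UNIV - {u, v})) ({0, 1} \<union> {2..<CARD('a)})"
    by (intro bij_betw_combine) auto
  moreover have "{u, v} \<union> (UNIV - {u, v}) = UNIV" by auto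
  moreover have "{0, 1} \<union> {2..<CARD('a)} = {0..<CARD('a)}" using n by auto
  ultimately have bij: "bij_betw f UNIV {0..<CARD('a)}" by simp
  have fn: "f a < CARD('a)" for a using bij by (auto simp: bij_betw_def)
  have "f a \<ge> 2" if "a \<notin> {u, v}" for a
  proof -
    have "g a \<in> {2..<CARD('a)}" using g that by (intro bij_betw_apply[OF g]) auto
    then show ?thesis using that by (simp add: f_def)
  qed
  then have part: "K11_part (f a) = (if a = u then 0 else if a = v then 1 else 2)" for a
  proof (cases "a \<in> {u, v}")
    case True
    then show ?thesis using assms(1) by (auto simp: K11_part_def f_def)
  next
    case False
    then show ?thesis using \<open>\<And>a. a \<notin> {u, v} \<Longrightarrow> f a \<ge> 2\<close>[of a] by (auto simp: K11_part_def)
  qed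
  have "E a b \<longleftrightarrow> K11 (CARD('a) - 2) (f a) (f b)" for a b
    unfolding K11_def E le_add_diff_inverse2[OF n] using assms(1) by (simp add: part fn)
  then show ?thesis using bij unfolding graph_iso_def by blast
qed

lemma K11_eigenvalue:
  fixes E :: "'a::finite \<Rightarrow> 'a \<Rightarrow> bool"
  assumes n: "CARD('a) \<ge> 2" and iso: "graph_iso E (K11 (CARD('a) - 2)) {0..<CARD('a)}"
    and r: "r\<^sup>2 - r = 2 * real CARD('a) - 4" "r \<noteq> 0"
  shows "adj_eigenvalue E r"
proof -
  obtain f where f: "bij_betw f UNIV {0..<CARD('a)}"
    and E: "\<And>a b. E a b \<longleftrightarrow> K11 (CARD('a) - 2) (f a) (f b)"
    using iso unfolding graph_iso_def by blast
  \<comment> \<open>An eigenvector constant on the large part and on the union of the singleton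
    parts. Rows of the large part give \<open>2 * r\<close>; the other two give
    \<open>r + 2 * (n - 2)\<close>, which is \<open>r\<^sup>2\<close> by the quadratic
    equation.\<close>
  define y where "y = (\<lambda>i::nat. if i < 2 then r else 2)"
  let ?K = "\<lambda>i j. if K11_part i \<noteq> K11_part j then 1 else (0::real)"
  have fn: "f a < CARD('a)" for a using f by (auto simp: bij_betw_def)
  have "(\<Sum>b\<in>UNIV. adj E a b * y (f b)) = r * y (f a)" for a
  proof -
    let ?i = "f a"
    have "(\<Sum>b\<in>UNIV. adj E a b * y (f b)) = (\<Sum>b\<in>UNIV. ?K ?i (f b) * y (f b))"
      unfolding adj_def E K11_def le_add_diff_inverse2[OF n] by (simp add: fn)
    also have "\<dots> = (\<Sum>j\<in>{0..<CARD('a)}. ?K ?i j * y j)"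
      by (rule sum.reindex_bij_betw[OF f])
    also have "{0..<CARD('a)} = {0, 1} \<union> {2..<CARD('a)}" using n by auto
    also have "(\<Sum>j\<in>\<dots>. ?K ?i j * y j)
      = (\<Sum>j\<in>{0, 1}. ?K ?i j * y j) + (\<Sum>j\<in>{2..<CARD('a)}. ?K ?i j * y j)"
      by (rule sum.union_disjoint) auto
    also have "(\<Sum>j\<in>{2..<CARD('a)}. ?K ?i j * y j)
      = (\<Sum>j\<in>{2..<CARD('a)}. if ?i < 2 then 2 else 0)"
      by (intro sum.cong) (auto simp: K11_part_def y_def)
    also have "\<dots> = (if ?i < 2 then 2 * (real CARD('a) - 2) else 0)" using n by simp
    also have "(\<Sum>j\<in>{0, 1}. ?K ?i j * y j) = (if ?i < 2 then r else 2 * r)"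
      by (auto simp: K11_part_def y_def)
    also have "(if ?i < 2 then r else 2 * r) + (if ?i < 2 then 2 * (real CARD('a) - 2) else 0)
      = r * y ?i" using r(1) by (auto simp: y_def power2_eq_square)
    finally show ?thesis .
  qed
  moreover have "(\<lambda>a. y (f a)) \<noteq> (\<lambda>_. 0)" using r(2) by (auto simp: y_def fun_eq_iff)
  ultimately show ?thesis unfolding adj_eigenvalue_def by blast
qed

subsection \<open>The Perron vector\<close>

text \<open>The matrix form gives access to the inner product and to compactness of the unit
  sphere.\<close>

definition adj_mat :: "('a::finite \<Rightarrow> 'a \<Rightarrow> bool) \<Rightarrow> real^'a^'a" where
  "adj_mat E = (\<chi> i j. adj E i j)"

lemma adj_mat_nth: "(adj_mat E *v y) $ v = (\<Sum>w\<in>UNIV. adj E v w * y $ w)"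
  by (simp add: adj_mat_def matrix_vector_mult_def)

lemma adj_mat_symmetric:
  assumes "simple_graph E"
  shows "y \<bullet> (adj_mat E *v z) = (adj_mat E *v y) \<bullet> z"
proof -
  have "adj E v w = adj E w v" for v w using assms by (auto simp: simple_graph_def adj_def)
  then have "transpose (adj_mat E) = adj_mat E" by (simp add: transpose_def adj_mat_def vec_eq_iff)
  then show ?thesis by (metis dot_lmul_matrix transpose_matrix_vector)
qed

lemma adj_eigenvalue_iff:
  "adj_eigenvalue E \<mu> \<longleftrightarrow> (\<exists>y. y \<noteq> 0 \<and> adj_mat E *v y = \<mu> *\<^sub>R y)"
proof
  assume "adj_eigenvalue E \<mu>"
  then obtain x where x: "x \<noteq> (\<lambda>_. 0)" "\<forall>v. (\<Sum>u\<in>UNIV. adj E v u * x u) = \<mu> * x v"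
    unfolding adj_eigenvalue_def by blast
  have "(\<chi> v. x v) \<noteq> 0" using x(1) by (auto simp: vec_eq_iff)
  moreover have "adj_mat E *v (\<chi> v. x v) = \<mu> *\<^sub>R (\<chi> v. x v)"
    using x(2) by (simp add: vec_eq_iff adj_mat_nth)
  ultimately show "\<exists>y. y \<noteq> 0 \<and> adj_mat E *v y = \<mu> *\<^sub>R y" by blast
next
  assume "\<exists>y. y \<noteq> 0 \<and> adj_mat E *v y = \<mu> *\<^sub>R y"
  then obtain y where y: "y \<noteq> 0" "adj_mat E *v y = \<mu> *\<^sub>R y" by blast
  have "(\<lambda>v. y $ v) \<noteq> (\<lambda>_. 0)" using y(1) by (auto simp: vec_eq_iff fun_eq_iff)
  moreover have "(\<Sum>u\<in>UNIV. adj E v u * y $ u) = \<mu> * y $ v" for v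
    using arg_cong[OF y(2), of "\<lambda>z. z $ v"] by (simp add: adj_mat_nth)
  ultimately show "adj_eigenvalue E \<mu>" unfolding adj_eigenvalue_def by blast
qed

text \<open>Eigenvectors of distinct eigenvalues are orthogonal.\<close>
lemma finite_adj_eigenvalues:
  fixes E :: "'a::finite \<Rightarrow> 'a \<Rightarrow> bool"
  assumes "simple_graph E"
  shows "finite {\<mu>. adj_eigenvalue E \<mu>}"
proof -
  let ?A = "adj_mat E" and ?L = "{\<mu>. adj_eigenvalue E \<mu>}"
  obtain f where f: "\<And>\<mu>. \<mu> \<in> ?L \<Longrightarrow> f \<mu> \<noteq> 0 \<and> ?A *v f \<mu> = \<mu> *\<^sub>R f \<mu>"
    using bchoice[of ?L "\<lambda>\<mu> y. y \<noteq> 0 \<and> ?A *v y = \<mu> *\<^sub>R y"] adj_eigenvalue_iff[of E] by auto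
  have orth: "f \<mu> \<bullet> f \<nu> = 0" if "\<mu> \<in> ?L" "\<nu> \<in> ?L" "\<mu> \<noteq> \<nu>" for \<mu> \<nu>
    using adj_mat_symmetric[OF assms, of "f \<mu>" "f \<nu>"] f[OF that(1)] f[OF that(2)] that(3) by auto
  have inj: "inj_on f ?L"
    using orth f by (intro inj_onI) (metis inner_eq_zero_iff)
  have "pairwise orthogonal (f ` ?L)"
    using orth by (auto simp: pairwise_def orthogonal_def)
  then have "independent (f ` ?L)"
    using f by (intro pairwise_orthogonal_independent) auto
  then have "finite (f ` ?L)" by (rule independent_imp_finite)
  then show ?thesis using inj by (rule finite_imageD)
qed

lemma adj_eigenvalue_le_spectral_radius:
  assumes "simple_graph E" "adj_eigenvalue E \<mu>"
  shows "\<mu> \<le> spectral_radius E"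
  unfolding spectral_radius_def using assms finite_adj_eigenvalues by (intro Max_ge) auto

text \<open>The form \<open>y \<bullet> A y - \<mu> (y \<bullet> y)\<close> is nowhere positive and
  vanishes at \<open>z\<close>. Moving from \<open>z\<close> along the residual \<open>d\<close>
  changes it to first order by \<open>2 t (d \<bullet> d)\<close>, so \<open>d\<close> must be
  0.\<close>

lemma rayleigh_max_eigenvector:
  assumes "simple_graph E"
    and max: "\<And>y. y \<bullet> (adj_mat E *v y) \<le> \<mu> * (y \<bullet> y)"
    and z: "z \<bullet> (adj_mat E *v z) = \<mu> * (z \<bullet> z)"
  shows "adj_mat E *v z = \<mu> *\<^sub>R z"
proof -
  let ?A = "adj_mat E"
  define d where "d = ?A *v z - \<mu> *\<^sub>R z"
  define c where "c = d \<bullet> (?A *v d) - \<mu> * (d \<bullet> d)"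
  have quad: "2 * t * (d \<bullet> d) + t\<^sup>2 * c \<le> 0" for t
  proof -
    have "(z + t *\<^sub>R d) \<bullet> (?A *v (z + t *\<^sub>R d)) - \<mu> * ((z + t *\<^sub>R d) \<bullet> (z + t *\<^sub>R d))
      = 2 * t * (d \<bullet> d) + t\<^sup>2 * c"
    proof -
      have "z \<bullet> (?A *v d) = d \<bullet> (?A *v z)"
        using adj_mat_symmetric[OF assms(1), of z d] by (simp add: inner_commute)
      moreover have "d \<bullet> (?A *v z) - \<mu> * (d \<bullet> z) = d \<bullet> d"
        by (simp add: d_def inner_diff_right)
      ultimately show ?thesis
        using z by (simp add: c_def matrix_vector_right_distrib matrix_vector_mult_scaleR
            inner_add_left inner_add_right algebra_simps power2_eq_square inner_commute[of z d])
    qed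
    then show ?thesis using max[of "z + t *\<^sub>R d"] by linarith
  qed
  have "d \<bullet> d = 0"
  proof (rule ccontr)
    assume "d \<bullet> d \<noteq> 0"
    then have pos: "d \<bullet> d > 0" by simp
    \<comment> \<open>Small enough that \<open>t * \<bar>c\<bar> < d \<bullet> d\<close>, so the
      linear term dominates; the added 1 keeps the denominator positive.\<close>
    define t where "t = (d \<bullet> d) / (\<bar>c\<bar> + 1)"
    have t: "t > 0" "t * (\<bar>c\<bar> + 1) = d \<bullet> d" using pos by (auto simp: t_def)
    have "2 * (d \<bullet> d) + t * c \<le> 0"
      using quad[of t] t(1) mult_le_cancel_left_pos[of t "2 * (d \<bullet> d) + t * c" 0]
      by (simp add: algebra_simps power2_eq_square)
    moreover have "t * c \<ge> - (t * \<bar>c\<bar>)"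
      using t(1) by (metis abs_ge_minus_self minus_le_iff mult_minus_right mult_left_mono less_imp_le)
    ultimately show False using t pos by (simp add: algebra_simps)
  qed
  then show ?thesis by (simp add: d_def)
qed

text \<open>A maximiser of the quadratic form on the unit sphere remains one after taking absolute
  values, since the matrix entries are nonnegative. It is therefore a nonnegative eigenvector, which
  is finally divided by its largest entry.\<close>

lemma perron_vector:
  fixes E :: "'a::finite \<Rightarrow> 'a \<Rightarrow> bool"
  assumes "simple_graph E"
  obtains x u where "\<And>v. 0 \<le> x v" "\<And>v. x v \<le> 1" "x u = 1"
    "\<And>v. (\<Sum>w\<in>UNIV. adj E v w * x w) = spectral_radius E * x v"
proof -
  let ?A = "adj_mat E"
  let ?S = "sphere 0 1 :: (real^'a) set"
  have cont: "continuous_on ?S (\<lambda>y. y \<bullet> (?A *v y))"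
    by (intro continuous_intros linear_continuous_on matrix_vector_mul_bounded_linear)
  obtain y0 where y0: "y0 \<in> ?S" "\<And>y. y \<in> ?S \<Longrightarrow> y \<bullet> (?A *v y) \<le> y0 \<bullet> (?A *v y0)"
    using continuous_attains_sup[OF compact_sphere _ cont] by auto
  define \<mu> where "\<mu> = y0 \<bullet> (?A *v y0)"
  have max: "y \<bullet> (?A *v y) \<le> \<mu> * (y \<bullet> y)" for y
  proof (cases "y = 0")
    case False
    define s where "s = y /\<^sub>R norm y"
    have s: "y = norm y *\<^sub>R s" "s \<in> ?S" using False by (simp_all add: s_def)
    have "y \<bullet> (?A *v y) = (norm y)\<^sup>2 * (s \<bullet> (?A *v s))"
      by (subst s(1), subst (2) s(1)) (simp add: matrix_vector_mult_scaleR power2_eq_square)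
    also have "\<dots> \<le> (norm y)\<^sup>2 * \<mu>" using y0(2)[OF s(2)] by (simp add: \<mu>_def mult_left_mono)
    finally show ?thesis by (simp add: power2_norm_eq_inner mult.commute)
  qed simp
  define z where "z = (\<chi> v. \<bar>y0 $ v\<bar>)"
  have zz: "z \<bullet> z = y0 \<bullet> y0" by (simp add: z_def inner_vec_def)
  have y00: "y0 \<bullet> y0 = 1" using y0(1) by (simp add: dot_square_norm)
  have expand: "y \<bullet> (?A *v y) = (\<Sum>v\<in>UNIV. \<Sum>w\<in>UNIV. adj E v w * (y $ v * y $ w))" for y
    by (simp add: inner_vec_def adj_mat_nth sum_distrib_left mult_ac)
  have "y0 $ v * y0 $ w \<le> \<bar>y0 $ v\<bar> * \<bar>y0 $ w\<bar>" for v w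
    by (metis abs_ge_self abs_mult)
  then have "y0 \<bullet> (?A *v y0) \<le> z \<bullet> (?A *v z)"
    unfolding expand by (auto simp: z_def adj_def intro!: sum_mono)
  then have "z \<bullet> (?A *v z) = \<mu> * (z \<bullet> z)"
    using max[of z] zz y00 by (simp add: \<mu>_def)
  then have Az: "?A *v z = \<mu> *\<^sub>R z" using rayleigh_max_eigenvector[OF assms max] by blast
  have "z \<bullet> z = 1" using zz y00 by (rule trans)
  then have z0: "z \<noteq> 0" by (metis inner_zero_left zero_neq_one)
  \<comment> \<open>Every eigenvalue is the Rayleigh quotient of its eigenvector, so the maximum
    \<open>\<mu>\<close> is the largest eigenvalue.\<close>
  have "\<nu> \<le> \<mu>" if ev: "adj_eigenvalue E \<nu>" for \<nu>
  proof -
    obtain y where y: "y \<noteq> 0" "?A *v y = \<nu> *\<^sub>R y"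
      using ev unfolding adj_eigenvalue_iff by blast
    then have "\<nu> * (y \<bullet> y) \<le> \<mu> * (y \<bullet> y)" using max[of y] by simp
    then show ?thesis using y(1) by simp
  qed
  then have rho: "spectral_radius E = \<mu>"
    unfolding spectral_radius_def
    using finite_adj_eigenvalues[OF assms] Az z0 adj_eigenvalue_iff[of E \<mu>]
    by (intro Max_eqI) auto
  define m where "m = Max (range (\<lambda>v. z $ v))"
  have zm: "z $ v \<le> m" for v by (simp add: m_def)
  have "m \<in> range (\<lambda>v. z $ v)" unfolding m_def by (rule Max_in) auto
  then obtain u where u: "z $ u = m" by auto
  have znn: "z $ v \<ge> 0" for v by (simp add: z_def)
  have "m > 0"
  proof (rule ccontr)
    assume "\<not> m > 0"
    then have "z $ v = 0" for v using zm[of v] znn[of v] by linarith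
    then show False using z0 by (simp add: vec_eq_iff)
  qed
  show ?thesis
  proof (rule that[of "\<lambda>v. z $ v / m" u])
    show "(\<Sum>w\<in>UNIV. adj E v w * (z $ w / m)) = spectral_radius E * (z $ v / m)" for v
      using arg_cong[OF Az, of "\<lambda>y. y $ v / m"] rho by (simp add: adj_mat_nth sum_divide_distrib)
  qed (use zm znn u \<open>m > 0\<close> in auto)
qed

section \<open>From the quadratic inequality to the closed form\<close>

theorem theorem1p1:
  fixes E :: "'a::finite \<Rightarrow> 'a \<Rightarrow> bool"
  assumes "CARD('a) \<ge> 3"
    and "simple_graph E"
    and "\<not> has_doubly_chorded_cycle E"
  shows "spectral_radius E \<le> 1/2 + sqrt (2 * real CARD('a) - 15/4)
       \<and> (spectral_radius E = 1/2 + sqrt (2 * real CARD('a) - 15/4)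
            \<longleftrightarrow> graph_iso E (K11 (CARD('a) - 2)) {0..<CARD('a)})"
proof -
  let ?\<rho> = "spectral_radius E"
  let ?r = "1/2 + sqrt (2 * real CARD('a) - 15/4)"
  have "(sqrt (2 * real CARD('a) - 15/4))\<^sup>2 = 2 * real CARD('a) - 15/4" using assms(1) by simp
  \<comment> \<open>\<open>?r\<close> is the larger root of
    \<open>t\<^sup>2 - t = 2n - 4\<close>.\<close>
  then have r: "?r\<^sup>2 - ?r = 2 * real CARD('a) - 4" by (simp add: power2_sum field_simps)
  have r0: "?r \<noteq> 0"
    using real_sqrt_ge_zero[of "2 * real CARD('a) - 15/4"] assms(1) by linarith
  obtain x u where x: "\<And>v. 0 \<le> x v" "\<And>v. x v \<le> 1" and u: "x u = 1"
    and eigen: "\<And>v. (\<Sum>w\<in>UNIV. adj E v w * x w) = ?\<rho> * x v"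
    by (rule perron_vector[OF assms(2)]) (rule that)
  interpret dcc_free_eigenvector E x ?\<rho>
  proof
    show "E w v" if "E v w" for v w using assms(2) that by (simp add: simple_graph_def)
    show "\<not> E v v" for v using assms(2) by (simp add: simple_graph_def)
  qed (use assms x eigen in simp_all)
  \<comment> \<open>Completing the square: \<open>15/4 = 4 - 1/4\<close>.\<close>
  have "(?\<rho> - 1/2)\<^sup>2 \<le> 2 * real CARD('a) - 15/4"
    using rho_le[OF u] by (simp add: power2_diff field_simps)
  then have "?\<rho> - 1/2 \<le> sqrt (2 * real CARD('a) - 15/4)" by (rule real_le_rsqrt)
  then have le: "?\<rho> \<le> ?r" by linarith
  have "graph_iso E (K11 (CARD('a) - 2)) {0..<CARD('a)}" if "?\<rho> = ?r"
  proof -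
    have eq: "?\<rho>\<^sup>2 - ?\<rho> = 2 * real CARD('a) - 4" unfolding that by (rule r)
    obtain v where "v \<noteq> u" "\<And>a b. E a b \<longleftrightarrow> a \<noteq> b \<and> (a \<in> {u, v} \<or> b \<in> {u, v})"
      by (rule extremal_structure[OF u eq]) (rule that)
    then show ?thesis by (rule graph_iso_K11I)
  qed
  moreover have "?\<rho> = ?r" if iso: "graph_iso E (K11 (CARD('a) - 2)) {0..<CARD('a)}"
  \<comment> \<open>Since \<open>?r\<close> is an eigenvalue of the extremal graph, it is at most
    the spectral radius; the upper bound gives the other direction.\<close>
  proof (rule antisym[OF le])
    have "CARD('a) \<ge> 2" using assms(1) by simp
    then have "adj_eigenvalue E ?r" using iso r r0 by (rule K11_eigenvalue)
    then show "?r \<le> ?\<rho>" by (rule adj_eigenvalue_le_spectral_radius[OF assms(2)])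
  qed
  ultimately show ?thesis using le by blast
qed

end
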